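(* Consider a dynamical system with state space $\mathcal S$, action space $\mathcal A$, disturbance space $\Omega$, transition function $f:\mathcal S\times\mathcal A\times\Omega\to\mathcal S$, feasible action sets $\mathcal A(s)\subseteq\mathcal A$ ($s\in\mathcal S$), an action $a^\phi$ with $a^\phi\in\mathcal A(s)$ for all $s\in\mathcal S$, and a policy $\pi:\mathcal S\times\Omega\to\mathcal A$ with $\pi(s,\omega)\in\mathcal A(s)$ for all $s,\omega$. Let $T\ge 1$ be a horizon, $s_1\in\mathcal S$ an initial state, $(\omega_t)_{t\in[T]}$ a disturbance sequence, and $\mathcal T_1,\dots,\mathcal T_M$ any partition of $[T]=\{1,\dots,T\}$ into $M$ disjoint sets. Let $(a_t^{\mathrm{seq}})_{t\in[T]}$ be the sequence of actions obtained by sequentially simulating $\pi$ from $s_1$. Then the Picard iteration converges in at most $T$ iterations (that is, $\alpha^k_t=a^{\mathrm{seq}}_t$ for all $t\in[T]$ and all $k\ge T$, where $\alpha^k$ is the action cache after $k$ iterations), and it returns $(a_t^{\mathrm{seq}})_{t\in[T]}$.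
   Context: Sequential simulation: $s^{\mathrm{seq}}_1=s_1$, $a_t^{\mathrm{seq}}=\pi(s_t^{\mathrm{seq}},\omega_t)$, $s^{\mathrm{seq}}_{t+1}=f(s^{\mathrm{seq}}_t,a^{\mathrm{seq}}_t,\omega_t)$ for $t\in[T]$. Picard iteration: Initialize the cache $\alpha^0_t=a^\phi$ for all $t\in[T]$. For $k=1,2,\dots$: each process $m\in\{1,\dots,M\}$ sets $s^{k,m}_1=s_1$ and, for $t=1,\dots,T$ in order, sets - $a^{k,m}_t=\pi(s^{k,m}_t,\omega_t)$ if $t\in\mathcal T_m$; - if $t\notin\mathcal T_m$: $a^{k,m}_t=\alpha^{k-1}_t$ if $\alpha^{k-1}_t\in\mathcal A(s^{k,m}_t)$, and $a^{k,m}_t=a^\phi$ otherwise; and then $s^{k,m}_{t+1}=f(s^{k,m}_t,a^{k,m}_t,\omega_t)$. After all processes finish, the cache is updated by $\alpha^k_t=a^{k,m}_t$, where $m$ is the unique process with $t\in\mathcal T_m$. If $\alpha^k_t=\alpha^{k-1}_t$ for all $t\in[T]$, the algorithm stops and returns $(\alpha^k_t)_{t\in[T]}$; otherwise it proceeds to $k+1$. The sequences $\alpha^k$ are regarded as defined for all $k\ge 0$ by the same recursion, whether or not the stopping test has been met. "The Picard iteration converges in at most $N$ iterations" means that $\alpha^k_t=a^{\mathrm{seq}}_t$ for all $t\in[T]$ and all $k\ge N$ (one additional iteration may be needed for the stopping test to detect this). *)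

theory Defs
  imports "HOL-Library.Disjoint_Sets" "HOL-Library.FuncSet"
begin

text \<open>
  The state, action and disturbance spaces are the types \<open>'s\<close>, \<open>'a\<close>, \<open>'w\<close>. Time runs over
  \<open>{1..T}\<close>; time-indexed sequences are functions on \<^typ>\<open>nat\<close> of which only the values at positive
  times matter. The value of a state trajectory at time 0 is a dummy.
\<close>

context
  fixes f :: "'s \<Rightarrow> 'a \<Rightarrow> 'w \<Rightarrow> 's"
    and \<pi> :: "'s \<Rightarrow> 'w \<Rightarrow> 'a"
    and s\<^sub>1 :: 's
    and \<omega> :: "nat \<Rightarrow> 'w"
begin

fun seq_state :: "nat \<Rightarrow> 's" where
  "seq_state 0 = s\<^sub>1"
| "seq_state (Suc 0) = s\<^sub>1"
| "seq_state (Suc (Suc t)) =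
     f (seq_state (Suc t)) (\<pi> (seq_state (Suc t)) (\<omega> (Suc t))) (\<omega> (Suc t))"

definition seq_action :: "nat \<Rightarrow> 'a" where
  "seq_action t = \<pi> (seq_state t) (\<omega> t)"

end

context
  fixes f :: "'s \<Rightarrow> 'a \<Rightarrow> 'w \<Rightarrow> 's"
    and feas :: "'s \<Rightarrow> 'a set"
    and a\<phi> :: 'a
    and \<pi> :: "'s \<Rightarrow> 'w \<Rightarrow> 'a"
    and s\<^sub>1 :: 's
    and \<omega> :: "nat \<Rightarrow> 'w"
begin

text \<open>
  One pass of a single process, given the set \<open>I\<close> of times assigned to it and the current
  cache \<open>\<alpha>\<close>. \<open>choose_action I \<alpha> t s\<close> is the action it takes at time \<open>t\<close> when in state \<open>s\<close>.
\<close>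

definition choose_action :: "nat set \<Rightarrow> (nat \<Rightarrow> 'a) \<Rightarrow> nat \<Rightarrow> 's \<Rightarrow> 'a" where
  "choose_action I \<alpha> t s =
     (if t \<in> I then \<pi> s (\<omega> t) else if \<alpha> t \<in> feas s then \<alpha> t else a\<phi>)"

fun process_state :: "nat set \<Rightarrow> (nat \<Rightarrow> 'a) \<Rightarrow> nat \<Rightarrow> 's" where
  "process_state I \<alpha> 0 = s\<^sub>1"
| "process_state I \<alpha> (Suc 0) = s\<^sub>1"
| "process_state I \<alpha> (Suc (Suc t)) =
     f (process_state I \<alpha> (Suc t))
       (choose_action I \<alpha> (Suc t) (process_state I \<alpha> (Suc t)))
       (\<omega> (Suc t))"

definition process_action :: "nat set \<Rightarrow> (nat \<Rightarrow> 'a) \<Rightarrow> nat \<Rightarrow> 'a" where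
  "process_action I \<alpha> t = choose_action I \<alpha> t (process_state I \<alpha> t)"

context
  fixes M :: nat
    and \<T> :: "nat \<Rightarrow> nat set"
begin

text \<open>
  The cache after \<open>k\<close> iterations, with no stopping test. The description operator picks out a
  well-defined process whenever \<open>t\<close> lies in exactly one of \<open>\<T> 1, \<dots>, \<T> M\<close>.
\<close>

primrec picard_cache :: "nat \<Rightarrow> nat \<Rightarrow> 'a" where
  "picard_cache 0 = (\<lambda>t. a\<phi>)"
| "picard_cache (Suc k) =
     (\<lambda>t. process_action (\<T> (THE m. m \<in> {1..M} \<and> t \<in> \<T> m)) (picard_cache k) t)"

definition picard_stop :: "nat \<Rightarrow> nat \<Rightarrow> bool" where
  "picard_stop T k \<longleftrightarrow> k \<ge> 1 \<and> (\<forall>t\<in>{1..T}. picard_cache k t = picard_cache (k - 1) t)"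

text \<open>
  The returned sequence is the cache at the first iteration passing the stopping test, restricted
  to \<open>{1..T}\<close>; \<^term>\<open>None\<close> means that the algorithm does not terminate.
\<close>

definition picard_output :: "nat \<Rightarrow> (nat \<Rightarrow> 'a) option" where
  "picard_output T =
     (if \<exists>k. picard_stop T k
      then Some (restrict (picard_cache (LEAST k. picard_stop T k)) {1..T})
      else None)"

end

end

end

theory Submission
  imports Defs
begin

text \<open>
  A process whose cache agrees with the sequential actions before time \<open>t\<close> reaches the sequential
  state at time \<open>t\<close>, so the owner of \<open>t\<close> computes the sequential action. By induction on \<open>k\<close>, the
  cache is correct up to time \<open>k\<close> after \<open>k\<close> iterations. The stopping test may succeed before
  iteration \<open>T\<close>, but then the cache is a fixed point on \<open>{1..T}\<close>, and by induction on time
  the only such fixed point is the sequential action sequence.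
\<close>

lemma process_state_eq_seq_state:
  assumes "\<And>s w. \<pi> s w \<in> feas s"
    and "\<And>u. 1 \<le> u \<Longrightarrow> u < t \<Longrightarrow> \<alpha> u = seq_action f \<pi> s\<^sub>1 \<omega> u"
  shows "process_state f feas a\<phi> \<pi> s\<^sub>1 \<omega> I \<alpha> t = seq_state f \<pi> s\<^sub>1 \<omega> t"
  using assms(2)
proof (induction t)
  case 0
  then show ?case by simp
next
  case (Suc t)
  show ?case
  \<comment> \<open>Times 0 and 1 both carry the initial state, so an action enters only from
    \<open>t = Suc v\<close> on.\<close>
  proof (cases t)
    case 0
    then show ?thesis by simp
  next
    case (Suc v)
    have "process_state f feas a\<phi> \<pi> s\<^sub>1 \<omega> I \<alpha> t = seq_state f \<pi> s\<^sub>1 \<omega> t"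
      using Suc.IH Suc.prems by simp
    moreover have "\<alpha> t = \<pi> (seq_state f \<pi> s\<^sub>1 \<omega> t) (\<omega> t)"
      using Suc.prems[of t] Suc by (simp add: seq_action_def)
    \<comment> \<open>Both kinds of step agree here: at a time outside \<open>I\<close> the cached
      action is the policy's own choice in the current state, hence feasible, and the fallback
      \<open>a\<phi>\<close> is not triggered.\<close>
    ultimately show ?thesis
      using assms(1) Suc by (simp add: choose_action_def)
  qed
qed

lemma process_action_eq_seq_action:
  assumes "\<And>s w. \<pi> s w \<in> feas s"
    and "\<And>u. 1 \<le> u \<Longrightarrow> u < t \<Longrightarrow> \<alpha> u = seq_action f \<pi> s\<^sub>1 \<omega> u"
    and "t \<in> I"
  shows "process_action f feas a\<phi> \<pi> s\<^sub>1 \<omega> I \<alpha> t = seq_action f \<pi> s\<^sub>1 \<omega> t"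
  using process_state_eq_seq_state[OF assms(1,2)] assms(3)
  by (simp add: process_action_def choose_action_def seq_action_def)

text \<open>Covering gives existence and disjointness uniqueness, so the description in
  \<open>picard_cache\<close> denotes a genuine owner. The partition enters the later lemmas only
  through this fact.\<close>

lemma mem_owner:
  assumes "(\<Union>m\<in>{1..M}. \<T> m) = {1..T}" and "disjoint_family_on \<T> {1..M}"
    and "t \<in> {1..T}"
  shows "t \<in> \<T> (THE m. m \<in> {1..M} \<and> t \<in> \<T> m)"
proof -
  have "\<exists>!m. m \<in> {1..M} \<and> t \<in> \<T> m"
    using assms unfolding disjoint_family_on_def by blast
  from theI'[OF this] show ?thesis by blast
qed

lemma picard_cache_eq_seq_action:
  assumes "\<And>s w. \<pi> s w \<in> feas s"
    and "\<And>u. u \<in> {1..T} \<Longrightarrow> u \<in> \<T> (THE m. m \<in> {1..M} \<and> u \<in> \<T> m)"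
    and "t \<in> {1..T}" and "t \<le> k"
  shows "picard_cache f feas a\<phi> \<pi> s\<^sub>1 \<omega> M \<T> k t = seq_action f \<pi> s\<^sub>1 \<omega> t"
  using assms(3,4)
proof (induction k arbitrary: t)
  case 0
  \<comment> \<open>Vacuous, since times start at 1.\<close>
  then show ?case by simp
next
  case (Suc k)
  show ?case
    unfolding picard_cache.simps
    \<comment> \<open>Times before \<open>t \<le> Suc k\<close> are at most \<open>k\<close>, so the
      induction hypothesis covers them in the cache that this pass reads.\<close>
    by (rule process_action_eq_seq_action) (use Suc assms(1,2) in auto)
qed

lemma picard_stop_imp_eq_seq_action:
  assumes "\<And>s w. \<pi> s w \<in> feas s"
    and "\<And>u. u \<in> {1..T} \<Longrightarrow> u \<in> \<T> (THE m. m \<in> {1..M} \<and> u \<in> \<T> m)"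
    and stop: "picard_stop f feas a\<phi> \<pi> s\<^sub>1 \<omega> M \<T> T k"
    and "t \<in> {1..T}"
  shows "picard_cache f feas a\<phi> \<pi> s\<^sub>1 \<omega> M \<T> k t = seq_action f \<pi> s\<^sub>1 \<omega> t"
  using assms(4)
proof (induction t rule: less_induct)
  case (less t)
  obtain j where k: "k = Suc j"
    using stop by (cases k) (auto simp: picard_stop_def)
  \<comment> \<open>The induction hypothesis concerns the cache after \<open>Suc j\<close>
    iterations; the stopping test carries it back to the cache after \<open>j\<close>, from which
    iteration \<open>Suc j\<close> is computed.\<close>
  have "picard_cache f feas a\<phi> \<pi> s\<^sub>1 \<omega> M \<T> j u = seq_action f \<pi> s\<^sub>1 \<omega> u"
    if "1 \<le> u" "u < t" for u
  proof -
    have "u \<in> {1..T}"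
      using that less.prems by auto
    then show ?thesis
      using less.IH[OF \<open>u < t\<close>] stop unfolding picard_stop_def k by simp
  qed
  then show ?case
    unfolding k picard_cache.simps
    by (rule process_action_eq_seq_action[where feas = feas, OF assms(1) _ assms(2)[OF less.prems]])
qed

theorem proposition2p1:
  fixes f :: "'s \<Rightarrow> 'a \<Rightarrow> 'w \<Rightarrow> 's"
    and feas :: "'s \<Rightarrow> 'a set"
    and a\<phi> :: 'a
    and \<pi> :: "'s \<Rightarrow> 'w \<Rightarrow> 'a"
    and s\<^sub>1 :: 's
    and \<omega> :: "nat \<Rightarrow> 'w"
    and T M :: nat
    and \<T> :: "nat \<Rightarrow> nat set"
  assumes default_feasible: "\<And>s. a\<phi> \<in> feas s"
    and policy_feasible: "\<And>s w. \<pi> s w \<in> feas s"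
    and horizon: "T \<ge> 1"
    and cover: "(\<Union>m\<in>{1..M}. \<T> m) = {1..T}"
    and disjoint: "disjoint_family_on \<T> {1..M}"
  shows "(\<forall>k\<ge>T. \<forall>t\<in>{1..T}.
            picard_cache f feas a\<phi> \<pi> s\<^sub>1 \<omega> M \<T> k t = seq_action f \<pi> s\<^sub>1 \<omega> t)
       \<and> picard_output f feas a\<phi> \<pi> s\<^sub>1 \<omega> M \<T> T
           = Some (restrict (seq_action f \<pi> s\<^sub>1 \<omega>) {1..T})"
proof -
  note owner = mem_owner[OF cover disjoint]
  let ?cache = "picard_cache f feas a\<phi> \<pi> s\<^sub>1 \<omega> M \<T>"
  let ?stop = "picard_stop f feas a\<phi> \<pi> s\<^sub>1 \<omega> M \<T> T"
  have conv: "?cache k t = seq_action f \<pi> s\<^sub>1 \<omega> t" if "k \<ge> T" "t \<in> {1..T}" for k t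
    by (rule picard_cache_eq_seq_action[where feas = feas and \<pi> = \<pi>, OF policy_feasible owner])
      (use that in auto)
  \<comment> \<open>The caches after \<open>T\<close> and \<open>Suc T\<close> iterations are both
    sequential, hence equal. The recursion stays folded so that \<open>conv\<close> can rewrite
    them.\<close>
  then have "?stop (Suc T)"
    by (simp add: picard_stop_def del: picard_cache.simps)
  then have ex: "\<exists>k. ?stop k" by blast
  then have "?stop (LEAST k. ?stop k)" by (rule LeastI_ex)
  then have "restrict (?cache (LEAST k. ?stop k)) {1..T} = restrict (seq_action f \<pi> s\<^sub>1 \<omega>) {1..T}"
    by (intro restrict_ext picard_stop_imp_eq_seq_action[where feas = feas and \<pi> = \<pi>, OF policy_feasible owner])
  with conv ex show ?thesis by (simp add: picard_output_def)
qed

end
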